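(* None of the concept languages $\mathcal{L}(\geq,\sqcup)$, $\mathcal{L}(\geq,\bot)$ and $\mathcal{L}(\forall,\exists,-,\sqcap)$ admits finite characterisations.
   Context: Fix infinite disjoint sets $N_C$, $N_R$ of concept and role names. For finite $\Sigma_C\subseteq N_C,\Sigma_R\subseteq N_R$ and a set $\mathbf O$ of constructors, $\mathcal L(\mathbf O)[\Sigma_C,\Sigma_R]$ is the set of concepts built from concept names in $\Sigma_C$ using only the constructors in $\mathbf O$: $\sqcup$ (union), $\sqcap$ (intersection), $\bot$ (empty concept), $\exists S.C$, $\forall S.C$, $\geq k\,S.C$ ($k\ge1$; at least $k$ pairwise distinct $S$-successors in $C$), where $S$ is a role name $R\in\Sigma_R$, or, only if $-\in\mathbf O$, its inverse $R^-$ (interpreted as the converse relation); standard semantics. $C\equiv D$ means $C^{\mathcal I}=D^{\mathcal I}$ for all interpretations. An example is a finite pointed interpretation $(\mathcal I,d)$ labelled positive or negative; $C$ fits $E=(E^+,E^-)$ if $d\in C^{\mathcal I}$ for positive and $d\notin C^{\mathcal I}$ for negative examples. A finite characterisation of $C$ w.r.t. $\mathcal L$ is a finite $E$ such that $C$ fits $E$ and every $D\in\mathcal L$ fitting $E$ is equivalent to $C$. $\mathcal L(\mathbf O)$ admits finite characterisations if for all finite $\Sigma_C,\Sigma_R$, every $C\in\mathcal L(\mathbf O)[\Sigma_C,\Sigma_R]$ has a finite characterisation w.r.t. $\mathcal L(\mathbf O)[\Sigma_C,\Sigma_R]$. *)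

theory Defs
  imports Main
begin

text \<open>
  The sets of concept names and role names are the universes of the type variables \<open>'c\<close> and \<open>'r\<close>
  (disjoint because they are different syntactic categories). Domains of interpretations are
  subsets of a type \<open>'d\<close>; all three types are assumed infinite where it matters.
\<close>

datatype 'r role = Role 'r | Inv 'r

datatype ('c, 'r) concept =
    CName 'c
  | CBot
  | CUnion "('c, 'r) concept" "('c, 'r) concept"
  | CInter "('c, 'r) concept" "('c, 'r) concept"
  | CEx "'r role" "('c, 'r) concept"
  | CAll "'r role" "('c, 'r) concept"
  | CAtLeast nat "'r role" "('c, 'r) concept"

datatype constr = KUnion | KInter | KBot | KEx | KAll | KAtLeast | KInv

definition allowed_roles :: "constr set \<Rightarrow> 'r set \<Rightarrow> 'r role set" where
  "allowed_roles Ops \<Sigma>R = Role ` \<Sigma>R \<union> (if KInv \<in> Ops then Inv ` \<Sigma>R else {})"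

inductive_set lang :: "constr set \<Rightarrow> 'c set \<Rightarrow> 'r set \<Rightarrow> ('c, 'r) concept set"
  for Ops :: "constr set" and \<Sigma>C :: "'c set" and \<Sigma>R :: "'r set" where
  name: "A \<in> \<Sigma>C \<Longrightarrow> CName A \<in> lang Ops \<Sigma>C \<Sigma>R"
| bot: "KBot \<in> Ops \<Longrightarrow> CBot \<in> lang Ops \<Sigma>C \<Sigma>R"
| union: "KUnion \<in> Ops \<Longrightarrow> C \<in> lang Ops \<Sigma>C \<Sigma>R \<Longrightarrow> D \<in> lang Ops \<Sigma>C \<Sigma>R \<Longrightarrow>
    CUnion C D \<in> lang Ops \<Sigma>C \<Sigma>R"
| inter: "KInter \<in> Ops \<Longrightarrow> C \<in> lang Ops \<Sigma>C \<Sigma>R \<Longrightarrow> D \<in> lang Ops \<Sigma>C \<Sigma>R \<Longrightarrow>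
    CInter C D \<in> lang Ops \<Sigma>C \<Sigma>R"
| ex: "KEx \<in> Ops \<Longrightarrow> S \<in> allowed_roles Ops \<Sigma>R \<Longrightarrow> C \<in> lang Ops \<Sigma>C \<Sigma>R \<Longrightarrow>
    CEx S C \<in> lang Ops \<Sigma>C \<Sigma>R"
| all: "KAll \<in> Ops \<Longrightarrow> S \<in> allowed_roles Ops \<Sigma>R \<Longrightarrow> C \<in> lang Ops \<Sigma>C \<Sigma>R \<Longrightarrow>
    CAll S C \<in> lang Ops \<Sigma>C \<Sigma>R"
| at_least: "KAtLeast \<in> Ops \<Longrightarrow> k \<ge> 1 \<Longrightarrow> S \<in> allowed_roles Ops \<Sigma>R \<Longrightarrow>
    C \<in> lang Ops \<Sigma>C \<Sigma>R \<Longrightarrow> CAtLeast k S C \<in> lang Ops \<Sigma>C \<Sigma>R"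

record ('c, 'r, 'd) interp =
  idom :: "'d set"
  iconc :: "'c \<Rightarrow> 'd set"
  irole :: "'r \<Rightarrow> ('d \<times> 'd) set"

definition is_interp :: "('c, 'r, 'd) interp \<Rightarrow> bool" where
  "is_interp I \<longleftrightarrow> idom I \<noteq> {} \<and> (\<forall>A. iconc I A \<subseteq> idom I) \<and>
     (\<forall>R. irole I R \<subseteq> idom I \<times> idom I)"

fun role_ext :: "('c, 'r, 'd) interp \<Rightarrow> 'r role \<Rightarrow> ('d \<times> 'd) set" where
  "role_ext I (Role R) = irole I R"
| "role_ext I (Inv R) = (irole I R)\<inverse>"

fun ext :: "('c, 'r, 'd) interp \<Rightarrow> ('c, 'r) concept \<Rightarrow> 'd set" where
  "ext I (CName A) = iconc I A"
| "ext I CBot = {}"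
| "ext I (CUnion C D) = ext I C \<union> ext I D"
| "ext I (CInter C D) = ext I C \<inter> ext I D"
| "ext I (CEx S C) = {d \<in> idom I. \<exists>e. (d, e) \<in> role_ext I S \<and> e \<in> ext I C}"
| "ext I (CAll S C) = {d \<in> idom I. \<forall>e. (d, e) \<in> role_ext I S \<longrightarrow> e \<in> ext I C}"
| "ext I (CAtLeast k S C) = {d \<in> idom I. \<exists>F. finite F \<and> card F = k \<and>
     (\<forall>e\<in>F. (d, e) \<in> role_ext I S \<and> e \<in> ext I C)}"

definition concept_equiv :: "'d itself \<Rightarrow> ('c, 'r) concept \<Rightarrow> ('c, 'r) concept \<Rightarrow> bool" where
  "concept_equiv _ C D \<longleftrightarrow> (\<forall>I :: ('c, 'r, 'd) interp. is_interp I \<longrightarrow> ext I C = ext I D)"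

type_synonym ('c, 'r, 'd) pointed = "('c, 'r, 'd) interp \<times> 'd"

definition is_example :: "('c, 'r, 'd) pointed \<Rightarrow> bool" where
  "is_example p \<longleftrightarrow> is_interp (fst p) \<and> finite (idom (fst p)) \<and> snd p \<in> idom (fst p)"

definition fits ::
  "('c, 'r) concept \<Rightarrow> ('c, 'r, 'd) pointed set \<times> ('c, 'r, 'd) pointed set \<Rightarrow> bool" where
  "fits C E \<longleftrightarrow> (\<forall>(I, d) \<in> fst E. d \<in> ext I C) \<and> (\<forall>(I, d) \<in> snd E. d \<notin> ext I C)"

definition finite_characterisation ::
  "('c, 'r) concept set \<Rightarrow> ('c, 'r) concept \<Rightarrow>
   ('c, 'r, 'd) pointed set \<times> ('c, 'r, 'd) pointed set \<Rightarrow> bool" where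
  "finite_characterisation L C E \<longleftrightarrow>
     finite (fst E) \<and> finite (snd E) \<and> (\<forall>p \<in> fst E \<union> snd E. is_example p) \<and>
     fits C E \<and> (\<forall>D \<in> L. fits D E \<longrightarrow> concept_equiv TYPE('d) D C)"

definition admits_finite_characterisations ::
  "'c itself \<Rightarrow> 'r itself \<Rightarrow> 'd itself \<Rightarrow> constr set \<Rightarrow> bool" where
  "admits_finite_characterisations _ _ _ Ops \<longleftrightarrow>
     (\<forall>(\<Sigma>C :: 'c set) (\<Sigma>R :: 'r set). finite \<Sigma>C \<longrightarrow> finite \<Sigma>R \<longrightarrow>
        (\<forall>C \<in> lang Ops \<Sigma>C \<Sigma>R.
           \<exists>E :: ('c, 'r, 'd) pointed set \<times> ('c, 'r, 'd) pointed set.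
             finite_characterisation (lang Ops \<Sigma>C \<Sigma>R) C E))"

end

theory Submission
  imports Defs
begin

text \<open>
  In each language some concept \<open>C\<close> can, for every bound \<open>N\<close>, be confused with an inequivalent
  concept \<open>D\<close> that has the same extension as \<open>C\<close> in all interpretations with at most \<open>N\<close> elements;
  a finite set of examples only involves domains of bounded size.

  With number restrictions, \<open>\<ge> (N+1) R.A\<close> is empty in small interpretations, so it is confused with
  \<open>\<bottom>\<close>, and \<open>A \<squnion> \<ge> (N+1) R.A\<close> with \<open>A\<close>. With inverses, \<open>A\<close> is confused with
  \<open>A \<sqinter> \<forall>R. \<dots> \<forall>R. \<exists>R\<^sup>-. \<dots> \<exists>R\<^sup>-. A\<close>, where \<open>N\<close> universal steps are followed by \<open>N + N!\<close> existential
  ones: a path with \<open>N\<close> edges in an interpretation with at most \<open>N\<close> elements meets a cycle, whose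
  length divides \<open>N!\<close>, so it can be pumped to a walk with \<open>N + N!\<close> edges between the same endpoints.
  On a simple path with \<open>N\<close> edges this fails.
\<close>

section \<open>Reduction to confusion on domains of bounded size\<close>

lemma ext_subset_idom: "is_interp I \<Longrightarrow> ext I C \<subseteq> idom I"
  by (induction C) (auto simp: is_interp_def)

lemma role_ext_subset: "is_interp I \<Longrightarrow> role_ext I S \<subseteq> idom I \<times> idom I"
  by (cases S) (auto simp: is_interp_def)

text \<open>Only finitely many domains occur in a candidate \<open>E\<close>, so their sizes have a
  common bound \<open>N\<close>. The concept confused with \<open>C\<close> up to size
  \<open>N\<close> fits \<open>E\<close> because \<open>C\<close> does, yet is not equivalent to
  \<open>C\<close>.\<close>

lemma not_admits_finite_characterisationsI:
  fixes C :: "('c, 'r) concept"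
  assumes "finite \<Sigma>C" "finite \<Sigma>R" "C \<in> lang Ops \<Sigma>C \<Sigma>R"
    and confused: "\<And>N. \<exists>D \<in> lang Ops \<Sigma>C \<Sigma>R. \<not> concept_equiv TYPE('d) D C \<and>
      (\<forall>I :: ('c, 'r, 'd) interp. is_interp I \<longrightarrow> finite (idom I) \<longrightarrow> card (idom I) \<le> N \<longrightarrow>
        ext I D = ext I C)"
  shows "\<not> admits_finite_characterisations TYPE('c) TYPE('r) TYPE('d) Ops"
proof
  assume "admits_finite_characterisations TYPE('c) TYPE('r) TYPE('d) Ops"
  then obtain E :: "('c, 'r, 'd) pointed set \<times> ('c, 'r, 'd) pointed set"
    where E: "finite_characterisation (lang Ops \<Sigma>C \<Sigma>R) C E"
    using assms(1-3) unfolding admits_finite_characterisations_def by blast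
  \<comment> \<open>The sum bounds every summand, and it needs no separate case when there are no
    examples.\<close>
  define N where "N = (\<Sum>p \<in> fst E \<union> snd E. card (idom (fst p)))"
  have fin: "finite (fst E \<union> snd E)"
    using E by (simp add: finite_characterisation_def)
  obtain D where D: "D \<in> lang Ops \<Sigma>C \<Sigma>R" "\<not> concept_equiv TYPE('d) D C"
    and same: "\<And>I :: ('c, 'r, 'd) interp. is_interp I \<Longrightarrow> finite (idom I) \<Longrightarrow>
      card (idom I) \<le> N \<Longrightarrow> ext I D = ext I C"
    using confused[of N] by blast
  have "ext (fst p) D = ext (fst p) C" if "p \<in> fst E \<union> snd E" for p
  proof (rule same)
    have "is_example p"
      using E that by (simp add: finite_characterisation_def)
    then show "is_interp (fst p)" "finite (idom (fst p))"
      by (simp_all add: is_example_def)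
    show "card (idom (fst p)) \<le> N"
      unfolding N_def using fin that by (intro member_le_sum) auto
  qed
  moreover have "fits C E"
    using E by (simp add: finite_characterisation_def)
  ultimately have "fits D E"
    by (fastforce simp: fits_def)
  then show False
    using E D by (auto simp: finite_characterisation_def)
qed

section \<open>Number restrictions\<close>

lemma ext_CAtLeast_eq_empty:
  assumes "is_interp I" "finite (idom I)" "card (idom I) < k"
  shows "ext I (CAtLeast k S C) = {}"
proof -
  have "card F < k" if "\<forall>e\<in>F. (d, e) \<in> role_ext I S" for d F
  proof -
    have "F \<subseteq> idom I"
      using that role_ext_subset[OF assms(1)] by blast
    then show ?thesis
      using assms card_mono by (metis le_less_trans)
  qed
  then show ?thesis
    by fastforce
qed

text \<open>The model is a star: a centre \<open>d\<close> outside \<open>A\<close> with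
  \<open>k\<close> successors in \<open>A\<close>. That \<open>d\<close> is not in \<open>A\<close>
  is what separates the union from \<open>A\<close> itself; for the language with bottom, a nonempty
  extension is enough.\<close>

lemma CAtLeast_satisfiable_outside:
  assumes "infinite (UNIV :: 'd set)"
  obtains I :: "('c, 'r, 'd) interp" and d
  where "is_interp I" "d \<notin> iconc I A" "d \<in> ext I (CAtLeast k (Role R) (CName A))"
proof -
  obtain F :: "'d set" where F: "finite F" "card F = k"
    using infinite_arbitrarily_large[OF assms] by blast
  obtain d where d: "d \<notin> F"
    using assms F(1) ex_new_if_finite by blast
  let ?I = "\<lparr>idom = insert d F, iconc = \<lambda>_. F, irole = \<lambda>_. {d} \<times> F\<rparr> :: ('c, 'r, 'd) interp"
  show thesis
  proof (rule that[of ?I d])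
    show "is_interp ?I"
      by (auto simp: is_interp_def)
    show "d \<notin> iconc ?I A"
      using d by simp
    show "d \<in> ext ?I (CAtLeast k (Role R) (CName A))"
      using F by auto
  qed
qed

theorem at_least_union_no_finite_characterisations:
  assumes "infinite (UNIV :: 'd set)"
  shows "\<not> admits_finite_characterisations TYPE('c) TYPE('r) TYPE('d) {KAtLeast, KUnion}"
proof -
  fix A :: 'c and R :: 'r
  let ?L = "lang {KAtLeast, KUnion} {A} {R}"
  show ?thesis
  proof (rule not_admits_finite_characterisationsI[of "{A}" "{R}" "CName A"])
    show "CName A \<in> ?L"
      by (simp add: lang.name)
    fix N
    let ?M = "CAtLeast (Suc N) (Role R) (CName A)"
    let ?D = "CUnion (CName A) ?M"
    have "?D \<in> ?L"
      by (intro lang.intros) (auto simp: allowed_roles_def)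
    moreover have "\<not> concept_equiv TYPE('d) ?D (CName A)"
    proof -
      obtain I :: "('c, 'r, 'd) interp" and d
        where "is_interp I" "d \<notin> iconc I A" "d \<in> ext I ?M"
        by (rule CAtLeast_satisfiable_outside[OF assms])
      then have "ext I ?D \<noteq> ext I (CName A)"
        by (metis UnCI ext.simps(1,3))
      then show ?thesis
        using \<open>is_interp I\<close> unfolding concept_equiv_def by blast
    qed
    moreover have "ext I ?D = ext I (CName A)"
      if "is_interp I" "finite (idom I)" "card (idom I) \<le> N" for I :: "('c, 'r, 'd) interp"
    proof -
      have "ext I ?M = {}"
        using that by (intro ext_CAtLeast_eq_empty) auto
      then show ?thesis
        by (metis Un_empty_right ext.simps(3))
    qed
    ultimately show "\<exists>D \<in> ?L. \<not> concept_equiv TYPE('d) D (CName A) \<and>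
      (\<forall>I :: ('c, 'r, 'd) interp. is_interp I \<longrightarrow> finite (idom I) \<longrightarrow> card (idom I) \<le> N \<longrightarrow>
        ext I D = ext I (CName A))"
      by blast
  qed auto
qed

theorem at_least_bot_no_finite_characterisations:
  assumes "infinite (UNIV :: 'd set)"
  shows "\<not> admits_finite_characterisations TYPE('c) TYPE('r) TYPE('d) {KAtLeast, KBot}"
proof -
  fix A :: 'c and R :: 'r
  let ?L = "lang {KAtLeast, KBot} {A} {R}"
  show ?thesis
  proof (rule not_admits_finite_characterisationsI[of "{A}" "{R}" CBot])
    show "CBot \<in> ?L"
      by (simp add: lang.bot)
    fix N
    let ?M = "CAtLeast (Suc N) (Role R) (CName A)"
    have "?M \<in> ?L"
      by (intro lang.intros) (auto simp: allowed_roles_def)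
    moreover have "\<not> concept_equiv TYPE('d) ?M CBot"
    proof -
      obtain I :: "('c, 'r, 'd) interp" and d
        where "is_interp I" "d \<notin> iconc I A" "d \<in> ext I ?M"
        by (rule CAtLeast_satisfiable_outside[OF assms])
      then show ?thesis
        unfolding concept_equiv_def by (metis empty_iff ext.simps(2))
    qed
    moreover have "ext I ?M = ext I CBot"
      if "is_interp I" "finite (idom I)" "card (idom I) \<le> N" for I :: "('c, 'r, 'd) interp"
      unfolding ext.simps(2) using that by (intro ext_CAtLeast_eq_empty) auto
    ultimately show "\<exists>D \<in> ?L. \<not> concept_equiv TYPE('d) D CBot \<and>
      (\<forall>I :: ('c, 'r, 'd) interp. is_interp I \<longrightarrow> finite (idom I) \<longrightarrow> card (idom I) \<le> N \<longrightarrow>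
        ext I D = ext I CBot)"
      by blast
  qed auto
qed

section \<open>Pumping walks in a finite relation\<close>

lemma relpow_self_mult: "(x, x) \<in> r ^^ l \<Longrightarrow> (x, x) \<in> r ^^ (l * k)"
  by (induction k) (auto simp: relpow_add)

text \<open>The \<open>n + 1\<close> positions of the walk take at most \<open>n\<close> values, so
  positions \<open>i < j\<close> share a vertex. The closed segment between them has length between
  1 and \<open>n\<close>, and repeating it adds exactly \<open>fact n\<close> edges, whatever that
  length is.\<close>

lemma relpow_pump:
  assumes "(x, y) \<in> r ^^ n" "r \<subseteq> S \<times> S" "x \<in> S" "finite S" "card S \<le> n"
  shows "(x, y) \<in> r ^^ (n + fact n)"
proof -
  obtain f where f: "f 0 = x" "f n = y" "\<And>i. i < n \<Longrightarrow> (f i, f (Suc i)) \<in> r"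
    using assms(1) unfolding relpow_fun_conv by blast
  have segment: "(f i, f j) \<in> r ^^ (j - i)" if "i \<le> j" "j \<le> n" for i j
    unfolding relpow_fun_conv using that f(3)
    by (intro exI[of _ "\<lambda>k. f (i + k)"]) auto
  have "f i \<in> S" if "i \<le> n" for i
  proof (cases i)
    case 0
    then show ?thesis
      using f(1) assms(3) by simp
  next
    case (Suc k)
    then show ?thesis
      using f(3)[of k] that assms(2) by auto
  qed
  then have "card (f ` {..n}) \<le> card S"
    using assms(4) by (intro card_mono) auto
  then have "card (f ` {..n}) < card {..n}"
    using assms(5) by simp
  then have "\<not> inj_on f {..n}"
    by (rule pigeonhole)
  then obtain i j where ij: "i < j" "j \<le> n" "f i = f j"
    by (metis atMost_iff linorder_inj_onI')
  have "j - i dvd fact n"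
    using ij by (intro dvd_fact) auto
  moreover have "(f i, f i) \<in> r ^^ (j - i)"
    using segment[of i j] ij by simp
  ultimately have "(f i, f i) \<in> r ^^ fact n"
    by (metis dvdE relpow_self_mult)
  \<comment> \<open>The original walk is cut at position \<open>i\<close>, where the closed walk of
    length \<open>fact n\<close> is inserted.\<close>
  moreover have "(x, f i) \<in> r ^^ i" "(f i, y) \<in> r ^^ (n - i)"
    using segment[of 0 i] segment[of i n] ij f(1,2) by simp_all
  ultimately have "(x, y) \<in> r ^^ (i + fact n + (n - i))"
    by (auto simp: relpow_add)
  then show ?thesis
    using ij by (simp add: add.commute add.left_commute)
qed

section \<open>Iterated quantifiers and the pumped concept\<close>

lemma lang_CEx_funpow:
  "KEx \<in> Ops \<Longrightarrow> S \<in> allowed_roles Ops \<Sigma>R \<Longrightarrow> C \<in> lang Ops \<Sigma>C \<Sigma>R \<Longrightarrow>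
    (CEx S ^^ n) C \<in> lang Ops \<Sigma>C \<Sigma>R"
  by (induction n) (auto intro: lang.ex)

lemma lang_CAll_funpow:
  "KAll \<in> Ops \<Longrightarrow> S \<in> allowed_roles Ops \<Sigma>R \<Longrightarrow> C \<in> lang Ops \<Sigma>C \<Sigma>R \<Longrightarrow>
    (CAll S ^^ n) C \<in> lang Ops \<Sigma>C \<Sigma>R"
  by (induction n) (auto intro: lang.all)

lemma relpow_Suc_iff: "(x, z) \<in> r ^^ Suc n \<longleftrightarrow> (\<exists>y. (x, y) \<in> r \<and> (y, z) \<in> r ^^ n)"
  by (blast dest: relpow_Suc_D2 intro: relpow_Suc_I2)

lemma ext_CEx_funpow:
  assumes "is_interp I"
  shows "d \<in> ext I ((CEx S ^^ n) C) \<longleftrightarrow> (\<exists>e. (d, e) \<in> role_ext I S ^^ n \<and> e \<in> ext I C)"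
proof (induction n arbitrary: d)
  case (Suc n)
  have "d \<in> ext I ((CEx S ^^ Suc n) C) \<longleftrightarrow>
    (\<exists>d'. (d, d') \<in> role_ext I S \<and> d' \<in> ext I ((CEx S ^^ n) C))"
    using role_ext_subset[OF assms, of S] by auto
  then show ?case
    unfolding Suc.IH relpow_Suc_iff by blast
qed simp

lemma ext_CAll_funpow:
  assumes "is_interp I"
  shows "d \<in> ext I ((CAll S ^^ n) C) \<longleftrightarrow>
    d \<in> idom I \<and> (\<forall>e. (d, e) \<in> role_ext I S ^^ n \<longrightarrow> e \<in> ext I C)"
proof (induction n arbitrary: d)
  case 0
  then show ?case
    using ext_subset_idom[OF assms] by auto
next
  case (Suc n)
  have "d \<in> ext I ((CAll S ^^ Suc n) C) \<longleftrightarrow>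
    d \<in> idom I \<and> (\<forall>d'. (d, d') \<in> role_ext I S \<longrightarrow> d' \<in> ext I ((CAll S ^^ n) C))"
    by simp
  then show ?case
    unfolding Suc.IH relpow_Suc_iff using role_ext_subset[OF assms, of S] by blast
qed

lemma relpow_converse:
  fixes r :: "('a \<times> 'a) set"
  shows "(r\<inverse>) ^^ n = (r ^^ n)\<inverse>"
proof (induction n)
  case (Suc n)
  have "(r\<inverse>) ^^ Suc n = r\<inverse> O (r ^^ n)\<inverse>"
    by (metis Suc.IH relpow.simps(2) relpow_commute)
  then show ?case
    by (simp add: converse_relcomp)
qed simp

definition pumped :: "nat \<Rightarrow> 'c \<Rightarrow> 'r \<Rightarrow> ('c, 'r) concept" where
  "pumped n A R =
    CInter (CName A) ((CAll (Role R) ^^ n) ((CEx (Inv R) ^^ (n + fact n)) (CName A)))"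

text \<open>Existential steps along the inverse role, read backwards, form a forward walk into
  \<open>e\<close>. Its start \<open>d'\<close> may be any element of \<open>A\<close>, not only
  \<open>d\<close>.\<close>

lemma ext_pumped:
  assumes "is_interp I"
  shows "d \<in> ext I (pumped n A R) \<longleftrightarrow> d \<in> iconc I A \<and>
    (\<forall>e. (d, e) \<in> irole I R ^^ n \<longrightarrow>
      (\<exists>d'. (d', e) \<in> irole I R ^^ (n + fact n) \<and> d' \<in> iconc I A))"
  using assms ext_subset_idom[OF assms, of "CName A"]
  by (auto simp: pumped_def ext_CAll_funpow ext_CEx_funpow relpow_converse)

text \<open>Pumping keeps both endpoints, so \<open>d\<close> itself serves as
  \<open>d'\<close>.\<close>

lemma ext_pumped_small:
  assumes "is_interp I" "finite (idom I)" "card (idom I) \<le> n"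
  shows "ext I (pumped n A R) = iconc I A"
proof -
  have "irole I R \<subseteq> idom I \<times> idom I" "iconc I A \<subseteq> idom I"
    using assms(1) by (simp_all add: is_interp_def)
  then have "\<forall>d \<in> iconc I A. \<forall>e. (d, e) \<in> irole I R ^^ n \<longrightarrow> (d, e) \<in> irole I R ^^ (n + fact n)"
    using relpow_pump[OF _ _ _ assms(2,3)] by blast
  then show ?thesis
    unfolding set_eq_iff ext_pumped[OF assms(1)] by blast
qed

text \<open>An infinite ray serves for all \<open>n\<close>, since equivalence also ranges over
  infinite interpretations. Having \<open>A\<close> only at its origin rules out any other start
  \<open>d'\<close>.\<close>

lemma not_concept_equiv_pumped:
  assumes "infinite (UNIV :: 'd set)"
  shows "\<not> concept_equiv TYPE('d) (pumped n A R :: ('c, 'r) concept) (CName A)"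
proof -
  obtain f :: "nat \<Rightarrow> 'd" where f: "inj f"
    using assms infinite_countable_subset by blast
  define I :: "('c, 'r, 'd) interp" where
    "I = \<lparr>idom = range f, iconc = \<lambda>_. {f 0}, irole = \<lambda>_. {(f i, f (Suc i)) | i. True}\<rparr>"
  have I: "is_interp I"
    by (auto simp: I_def is_interp_def)
  \<comment> \<open>The role is the successor function along the ray, so the length of a walk
    determines its endpoint.\<close>
  have walk: "(f i, e) \<in> irole I R ^^ k \<longleftrightarrow> e = f (i + k)" for i k e
  proof (induction k arbitrary: e)
    case (Suc k)
    have "(f i, e) \<in> irole I R ^^ Suc k \<longleftrightarrow> (f (i + k), e) \<in> irole I R"
      using Suc.IH by auto
    then show ?case
      using f by (auto simp: I_def inj_eq)
  qed auto
  have "f 0 \<notin> ext I (pumped n A R)"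
  proof
    assume "f 0 \<in> ext I (pumped n A R)"
    moreover have "(f 0, f n) \<in> irole I R ^^ n"
      by (simp add: walk)
    ultimately obtain d where "(d, f n) \<in> irole I R ^^ (n + fact n)" "d \<in> iconc I A"
      unfolding ext_pumped[OF I] by blast
    then have "(f 0, f n) \<in> irole I R ^^ (n + fact n)"
      by (simp add: I_def)
    \<comment> \<open>By \<open>walk\<close> and injectivity \<open>n = n + fact n\<close>, but
      \<open>fact n\<close> is positive.\<close>
    then show False
      using f by (simp add: walk inj_eq)
  qed
  moreover have "f 0 \<in> ext I (CName A)"
    by (simp add: I_def)
  ultimately show ?thesis
    using I unfolding concept_equiv_def by blast
qed

theorem all_ex_inv_inter_no_finite_characterisations:
  assumes "infinite (UNIV :: 'd set)"
  shows "\<not> admits_finite_characterisations TYPE('c) TYPE('r) TYPE('d) {KAll, KEx, KInv, KInter}"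
proof -
  fix A :: 'c and R :: 'r
  let ?L = "lang {KAll, KEx, KInv, KInter} {A} {R}"
  show ?thesis
  proof (rule not_admits_finite_characterisationsI[of "{A}" "{R}" "CName A"])
    show "CName A \<in> ?L"
      by (simp add: lang.name)
    fix N
    have "pumped N A R \<in> ?L"
      unfolding pumped_def
      by (intro lang.inter lang_CAll_funpow lang_CEx_funpow lang.name)
        (auto simp: allowed_roles_def)
    then show "\<exists>D \<in> ?L. \<not> concept_equiv TYPE('d) D (CName A) \<and>
      (\<forall>I :: ('c, 'r, 'd) interp. is_interp I \<longrightarrow> finite (idom I) \<longrightarrow> card (idom I) \<le> N \<longrightarrow>
        ext I D = ext I (CName A))"
      using not_concept_equiv_pumped[OF assms] ext_pumped_small by fastforce
  qed auto
qed

theorem theorem11: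
  assumes "infinite (UNIV :: 'c set)" and "infinite (UNIV :: 'r set)"
    and "infinite (UNIV :: 'd set)"
  shows "\<not> admits_finite_characterisations TYPE('c) TYPE('r) TYPE('d) {KAtLeast, KUnion} \<and>
         \<not> admits_finite_characterisations TYPE('c) TYPE('r) TYPE('d) {KAtLeast, KBot} \<and>
         \<not> admits_finite_characterisations TYPE('c) TYPE('r) TYPE('d) {KAll, KEx, KInv, KInter}"
  using assms(3) by (intro conjI at_least_union_no_finite_characterisations
    at_least_bot_no_finite_characterisations all_ex_inv_inter_no_finite_characterisations)

end
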